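(* $WAR(Pm(NP))\le\frac{3}{2}$ for every integer $m\ge 4$, and $WAR(P3(NP))\le\sqrt{5}-1$.
   Context: Scheduling setting: there are $n$ jobs $J_1,\dots,J_n$ and $m$ identical machines $M_1,\dots,M_m$; job $J_j$ has processing time $p_j>0$ on every machine. $Pm(NP)$ denotes the problem in which each job must be processed non-preemptively (entirely, without interruption) on a single machine, each machine processing at most one job at a time, all starting at time $0$. For a feasible schedule $S$, the load $L^S_i$ of $M_i$ is the time by which $M_i$ finishes all processing assigned to it, and $L(S)=(L^S_1,\dots,L^S_m)$ is the load vector. For $X\in\mathbb{R}^m$ let $\overleftarrow{X}$ be $X$ sorted in non-increasing order and $\sigma(X)$ the vector of prefix sums; write $X\preceq_s Y$ if $\sigma(\overleftarrow{X})\le\sigma(\overleftarrow{Y})$ coordinatewise. For an instance $\mathcal{I}$ with set of feasible schedules $\mathcal{S}$, and $S\in\mathcal{S}$, let $s(S)$ be the infimum of $\alpha$ such that $L(S)\preceq_s \alpha L(T)$ for all $T\in\mathcal{S}$; let $s^*(\mathcal{I})=\inf_{S\in\mathcal{S}}s(S)$. The weak simultaneous approximation ratio of a problem $\mathcal{P}$ is $WAR(\mathcal{P})=\sup_{\mathcal{I}}s^*(\mathcal{I})$, the supremum over all instances of $\mathcal{P}$ (with $m$ fixed). *)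

theory Defs
  imports "HOL-Analysis.Analysis"
begin

definition sort_desc :: "real list \<Rightarrow> real list" where
  "sort_desc X = rev (sort X)"

definition prefix_sums :: "real list \<Rightarrow> real list" where
  "prefix_sums X = map (\<lambda>k. sum_list (take (Suc k) X)) [0..<length X]"

definition weakly_submajorized :: "real list \<Rightarrow> real list \<Rightarrow> bool"  (infix "\<preceq>\<^sub>s" 50) where
  "X \<preceq>\<^sub>s Y \<longleftrightarrow> list_all2 (\<le>) (prefix_sums (sort_desc X)) (prefix_sums (sort_desc Y))"

text \<open>
  An instance is the list \<open>p\<close> of the processing times; jobs are the indices \<open>j < length p\<close> and
  machines are the indices \<open>i < m\<close>.
\<close>

definition instances :: "real list set" where
  "instances = {p. \<forall>j < length p. p ! j > 0}"

text \<open>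
  Job \<open>j\<close> occupies machine \<open>machine S j\<close> during the whole interval from \<open>start S j\<close> to
  \<open>start S j + p ! j\<close>. Machines are available from time 0 and may be idle between jobs.
\<close>

record schedule =
  machine :: "nat \<Rightarrow> nat"
  start :: "nat \<Rightarrow> real"

definition feasible :: "nat \<Rightarrow> real list \<Rightarrow> schedule set" where
  "feasible m p = {S.
     (\<forall>j < length p. machine S j < m \<and> start S j \<ge> 0) \<and>
     (\<forall>j < length p. \<forall>k < length p. j \<noteq> k \<and> machine S j = machine S k \<longrightarrow>
        {start S j ..< start S j + p ! j} \<inter> {start S k ..< start S k + p ! k} = {})}"

text \<open>The load of a machine to which no job is assigned is 0.\<close>

definition load :: "real list \<Rightarrow> schedule \<Rightarrow> nat \<Rightarrow> real" where
  "load p S i = Max (insert 0 {start S j + p ! j | j. j < length p \<and> machine S j = i})"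

definition load_vector :: "nat \<Rightarrow> real list \<Rightarrow> schedule \<Rightarrow> real list" where
  "load_vector m p S = map (load p S) [0..<m]"

text \<open>
  Infima and suprema are taken in the extended reals, so that they always have their usual
  meaning; in particular an infimum over the empty set is \<open>\<infinity>\<close>. For the instance without jobs,
  \<open>s_opt\<close> is \<open>-\<infinity>\<close>, which does not affect the supremum in \<open>WAR_NP\<close>.
\<close>

definition s_ratio :: "nat \<Rightarrow> real list \<Rightarrow> schedule \<Rightarrow> ereal" where
  "s_ratio m p S = Inf {ereal \<alpha> | \<alpha>. \<forall>T \<in> feasible m p.
     load_vector m p S \<preceq>\<^sub>s map ((*) \<alpha>) (load_vector m p T)}"

definition s_opt :: "nat \<Rightarrow> real list \<Rightarrow> ereal" where
  "s_opt m p = (INF S \<in> feasible m p. s_ratio m p S)"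

definition WAR_NP :: "nat \<Rightarrow> ereal" where
  "WAR_NP m = (SUP p \<in> instances. s_opt m p)"

end

theory Submission
  imports Defs
begin

text \<open>
  The LPT schedule attains both bounds. Weak submajorization of \<open>X\<close> by \<open>Y\<close> follows from
  \<open>\<Sum> (x - t)\<^sup>+ \<le> \<Sum> (y - t)\<^sup>+\<close> for all thresholds \<open>t \<ge> 0\<close>, so it suffices to compare the total
  excess of the LPT loads over \<open>\<alpha>\<tau>\<close> with \<open>\<alpha>\<close> times that of an arbitrary schedule over \<open>\<tau>\<close>.

  For \<open>\<alpha> = 3/2\<close>: if all LPT loads are at least \<open>\<tau>\<close>, comparing the total loads is enough. Otherwise
  some load is below \<open>\<tau>\<close>, hence so is every load just before its last job \<open>q\<close> is added, and the
  excess is at most \<open>(p\<^sub>q - \<tau>)\<^sup>+\<close> if \<open>q\<close> is one of the \<open>m\<close> largest jobs and \<open>(p\<^sub>q - \<tau>/2)\<^sup>+\<close> if not. The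
  sum of these bounds over all jobs is a lower bound for the excess over \<open>\<tau>\<close> in every schedule.

  For \<open>m = 3\<close> even \<open>\<alpha> = 11/9 < \<surd>5 - 1\<close> works: the largest load is handled by Graham's argument, and
  the sum of the two largest ones by the fact that a machine with at least two jobs has at most twice
  the load of any other machine.
\<close>

section \<open>Weak submajorization and a rearrangement bound for sums\<close>

lemma weakly_submajorizedI:
  assumes len: "length X = length Y"
    and nonneg: "\<And>y. y \<in> set Y \<Longrightarrow> 0 \<le> y"
    and excess: "\<And>t. 0 \<le> t \<Longrightarrow> (\<Sum>x\<leftarrow>X. max 0 (x - t)) \<le> (\<Sum>y\<leftarrow>Y. max 0 (y - t))"
  shows "X \<preceq>\<^sub>s Y"
proof -
  define xs ys where "xs = sort_desc X" and "ys = sort_desc Y"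
  have lens: "length xs = length X" "length ys = length X"
    using len by (simp_all add: xs_def ys_def sort_desc_def)
  have msets: "mset xs = mset X" "mset ys = mset Y"
    by (simp_all add: xs_def ys_def sort_desc_def)
  have desc: "ys ! j \<le> ys ! i" if "i \<le> j" "j < length ys" for i j
    using that by (auto simp: ys_def sort_desc_def rev_nth intro!: sorted_nth_mono)
  have "sum_list (take (Suc k) xs) \<le> sum_list (take (Suc k) ys)" if k: "k < length X" for k
  proof -
    \<comment> \<open>At this threshold the first \<open>Suc k\<close> entries of \<open>ys\<close>
      carry the whole excess and none of them is cut off at 0, so the excess of \<open>ys\<close> is
      exactly its prefix sum minus \<open>Suc k * t\<close>. For \<open>xs\<close> the same
      expression is only a lower bound of the excess.\<close>
    define t where "t = ys ! k"
    have t0: "0 \<le> t"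
    proof -
      have "ys ! k \<in> set ys" using k lens by simp
      then have "ys ! k \<in> set Y" using msets(2) by (metis set_mset_mset)
      then show ?thesis using nonneg by (simp add: t_def)
    qed
    let ?e = "\<lambda>x. max 0 (x - t)"
    have split: "(\<Sum>x\<leftarrow>zs. ?e x) = (\<Sum>x\<leftarrow>take (Suc k) zs. ?e x) + (\<Sum>x\<leftarrow>drop (Suc k) zs. ?e x)" for zs
      by (metis append_take_drop_id map_append sum_list_append)
    have shift: "(\<Sum>x\<leftarrow>zs. x - t) = sum_list zs - real (length zs) * t" for zs
      by (induction zs) (auto simp: algebra_simps)
    have "sum_list (take (Suc k) xs) - real (Suc k) * t = (\<Sum>x\<leftarrow>take (Suc k) xs. x - t)"
      using k lens by (simp add: shift)
    also have "\<dots> \<le> (\<Sum>x\<leftarrow>take (Suc k) xs. ?e x)"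
      by (rule sum_list_mono) simp
    also have "\<dots> \<le> (\<Sum>x\<leftarrow>xs. ?e x)"
      unfolding split[of xs] by (auto intro!: sum_list_nonneg)
    also have "\<dots> = (\<Sum>x\<leftarrow>X. ?e x)"
      by (metis msets(1) mset_map sum_mset_sum_list)
    also have "\<dots> \<le> (\<Sum>y\<leftarrow>Y. ?e y)" by (rule excess[OF t0])
    also have "\<dots> = (\<Sum>y\<leftarrow>ys. ?e y)"
      by (metis msets(2) mset_map sum_mset_sum_list)
    also have "\<dots> = (\<Sum>y\<leftarrow>take (Suc k) ys. ?e y) + (\<Sum>y\<leftarrow>drop (Suc k) ys. ?e y)"
      by (rule split)
    also have "map ?e (take (Suc k) ys) = map (\<lambda>y. y - t) (take (Suc k) ys)"
      using k lens desc by (auto simp: in_set_conv_nth t_def)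
    also have "map ?e (drop (Suc k) ys) = map (\<lambda>y. 0) (drop (Suc k) ys)"
      using k lens by (auto simp: in_set_conv_nth t_def max_def intro!: antisym desc)
    also have "(\<Sum>y\<leftarrow>take (Suc k) ys. y - t) + (\<Sum>y\<leftarrow>drop (Suc k) ys. 0)
        = sum_list (take (Suc k) ys) - real (Suc k) * t"
      using k lens by (simp add: shift)
    finally show ?thesis by simp
  qed
  then show ?thesis
    using lens unfolding weakly_submajorized_def prefix_sums_def xs_def[symmetric] ys_def[symmetric]
    by (auto simp: list_all2_conv_all_nth)
qed

text \<open>Exchange argument: indices of \<open>D\<close> beyond the initial segment of length
  \<open>r = min m n\<close> have values at most \<open>g r\<close>, segment indices missing from
  \<open>D\<close> have values at least \<open>g r\<close>, and there are at least as many of the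
  latter.\<close>

lemma sum_le_sum_initial_segment:
  fixes g :: "nat \<Rightarrow> real"
  assumes nonneg: "\<And>j. 0 \<le> g j"
    and anti: "\<And>j k. j \<le> k \<Longrightarrow> k < n \<Longrightarrow> g k \<le> g j"
    and D: "D \<subseteq> {..<n}" "card D \<le> m"
  shows "sum g D \<le> (\<Sum>j | j < n \<and> j < m. g j)"
proof -
  define r where "r = min m n"
  define M where "M = {..<r}"
  have eq: "{j. j < n \<and> j < m} = M" by (auto simp: M_def r_def)
  have fin: "finite D" using D(1) finite_subset by blast
  have cD: "card D \<le> r"
    using D card_mono[OF _ D(1)] by (auto simp: r_def)
  have "sum g D \<le> sum g M"
  proof (cases "D \<subseteq> M")
    case True
    then show ?thesis by (intro sum_mono2) (auto simp: M_def nonneg)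
  next
    case False
    then obtain d where "d \<in> D" "r \<le> d" by (metis M_def lessThan_iff not_le subsetI)
    with D have rn: "r < n" by auto
    have "card (D - M) \<le> card (M - D)"
    proof -
      have "card D = card (D \<inter> M) + card (D - M)"
        using fin by (metis card_Diff_subset_Int card_mono finite_Int inf_le1 le_add_diff_inverse)
      moreover have "card M = card (M \<inter> D) + card (M - D)"
        by (metis M_def card_Diff_subset_Int card_mono finite_Int finite_lessThan inf_le1 le_add_diff_inverse)
      ultimately show ?thesis using cD by (simp add: M_def Int_commute)
    qed
    have "sum g (D - M) \<le> of_nat (card (D - M)) * g r"
      using D rn by (intro sum_bounded_above anti) (auto simp: M_def)
    also have "\<dots> \<le> of_nat (card (M - D)) * g r"
      using \<open>card (D - M) \<le> card (M - D)\<close> nonneg by (intro mult_right_mono) auto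
    also have "\<dots> \<le> sum g (M - D)"
      using rn by (intro sum_bounded_below anti) (auto simp: M_def)
    finally have *: "sum g (D - M) \<le> sum g (M - D)" .
    have "sum g D = sum g (D \<inter> M) + sum g (D - M)"
      using fin by (simp add: sum.Int_Diff)
    moreover have "sum g M = sum g (M \<inter> D) + sum g (M - D)"
      by (simp add: M_def sum.Int_Diff)
    ultimately show ?thesis using * by (simp add: Int_commute)
  qed
  then show ?thesis by (simp add: eq)
qed

section \<open>Machine loads, list scheduling and a lower bound for the excess\<close>

text \<open>The prefix length acts as a stage of the construction:
  \<open>assigned_load c f j (f j)\<close> is the load that job \<open>j\<close> meets on its
  machine when jobs are placed in index order.\<close>

definition assigned_load :: "(nat \<Rightarrow> real) \<Rightarrow> (nat \<Rightarrow> nat) \<Rightarrow> nat \<Rightarrow> nat \<Rightarrow> real" where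
  "assigned_load c f n i = (\<Sum>j | j < n \<and> f j = i. c j)"

lemma assigned_load_Suc:
  "assigned_load c f (Suc n) i = assigned_load c f n i + (if f n = i then c n else 0)"
proof -
  have "{j. j < Suc n \<and> f j = i} = (if f n = i then insert n {j. j < n \<and> f j = i} else {j. j < n \<and> f j = i})"
    by (auto simp: less_Suc_eq)
  then show ?thesis by (simp add: assigned_load_def)
qed

lemma assigned_load_cong:
  "(\<And>j. j < n \<Longrightarrow> f j = g j) \<Longrightarrow> assigned_load c f n i = assigned_load c g n i"
  unfolding assigned_load_def by (intro sum.cong) auto

lemma assigned_load_eq_0: "(\<And>j. j < n \<Longrightarrow> f j \<noteq> i) \<Longrightarrow> assigned_load c f n i = 0"
  unfolding assigned_load_def by (rule sum.neutral) auto

lemma sum_assigned_load: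
  assumes "\<And>j. j < n \<Longrightarrow> f j < m"
  shows "(\<Sum>i<m. assigned_load c f n i) = (\<Sum>j<n. c j)"
  using sum.group[of "{..<n}" "{..<m}" f c] assms by (auto simp: assigned_load_def)

lemma assigned_load_ge:
  assumes "\<And>j. j < n \<Longrightarrow> 0 \<le> c j" "A \<subseteq> {j. j < n \<and> f j = i}"
  shows "sum c A \<le> assigned_load c f n i"
  unfolding assigned_load_def by (intro sum_mono2) (use assms in auto)

text \<open>Greedy construction: job \<open>n\<close> joins a machine of least current load, and
  changing \<open>f\<close> at \<open>n\<close> alone leaves the loads of all prefixes up to
  \<open>n\<close> intact.\<close>

lemma ex_list_schedule:
  fixes c :: "nat \<Rightarrow> real"
  assumes "0 < m"
  shows "\<exists>f. (\<forall>j<n. f j < m) \<and>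
    (\<forall>j<n. \<forall>i<m. assigned_load c f j (f j) \<le> assigned_load c f j i)"
proof (induction n)
  case (Suc n)
  then obtain f where f: "\<forall>j<n. f j < m"
    "\<forall>j<n. \<forall>i<m. assigned_load c f j (f j) \<le> assigned_load c f j i" by blast
  define v where "v = Min (assigned_load c f n ` {..<m})"
  have "v \<in> assigned_load c f n ` {..<m}"
    unfolding v_def using assms by (intro Min_in) auto
  then obtain i0 where i0: "i0 < m" "v = assigned_load c f n i0" by auto
  have min: "v \<le> assigned_load c f n i" if "i < m" for i
    unfolding v_def using that by auto
  define g where "g = f(n := i0)"
  have same: "assigned_load c g j i = assigned_load c f j i" if "j \<le> n" for i j
    using that by (intro assigned_load_cong) (auto simp: g_def)
  have "(\<forall>j<Suc n. g j < m) \<and>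
      (\<forall>j<Suc n. \<forall>i<m. assigned_load c g j (g j) \<le> assigned_load c g j i)"
  proof (intro conjI allI impI)
    fix j i assume "j < Suc n" "i < m"
    then show "assigned_load c g j (g j) \<le> assigned_load c g j i"
      using f i0 min by (cases "j = n") (simp_all add: same, simp_all add: g_def)
  qed (use f i0 in \<open>auto simp: g_def less_Suc_eq\<close>)
  then show ?case by blast
qed auto

text \<open>
  The first job of each machine contributes its excess over \<open>\<tau>\<close>, every further one its excess over
  \<open>\<tau> / 2\<close>; since there are at most \<open>m\<close> first jobs, the sum is least when they are the \<open>m\<close> largest.
\<close>

lemma excess_lower_bound:
  fixes c :: "nat \<Rightarrow> real"
  assumes pos: "\<And>j. j < n \<Longrightarrow> 0 < c j"
    and anti: "\<And>j k. j \<le> k \<Longrightarrow> k < n \<Longrightarrow> c k \<le> c j"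
    and h: "\<And>j. j < n \<Longrightarrow> h j < m"
    and \<tau>: "0 \<le> \<tau>"
  shows "(\<Sum>j<n. if j < m then max 0 (c j - \<tau>) else max 0 (c j - \<tau> / 2))
    \<le> (\<Sum>i<m. max 0 (assigned_load c h n i - \<tau>))"
proof -
  define u where "u = (\<lambda>j. max 0 (c j - \<tau> / 2))"
  \<comment> \<open>The loss from charging job \<open>j\<close> at threshold \<open>\<tau>\<close>
    instead of \<open>\<tau> / 2\<close>. It is non-increasing in \<open>j\<close>, so the first
    jobs \<open>D\<close> lose at most as much as the \<open>m\<close> largest jobs.\<close>
  define g where "g = (\<lambda>j. u j - max 0 (c j - \<tau>))"
  define D where "D = {k. k < n \<and> (\<forall>j<k. h j \<noteq> h k)}"
  have "inj_on h D"
    by (auto simp: inj_on_def D_def) (metis linorder_neqE_nat)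
  moreover have "h ` D \<subseteq> {..<m}" using h by (auto simp: D_def)
  ultimately have card: "card D \<le> m"
    by (metis card_image card_lessThan card_mono finite_lessThan)
  have g0: "0 \<le> g j" for j using \<tau> by (auto simp: g_def u_def)
  have ganti: "g k \<le> g j" if "j \<le> k" "k < n" for j k
    using anti[OF that] \<tau> by (auto simp: g_def u_def max_def)
  have gD: "sum g D \<le> (\<Sum>j | j < n \<and> j < m. g j)"
    by (rule sum_le_sum_initial_segment[OF g0 ganti _ card]) (auto simp: D_def)
  have machine: "(\<Sum>j | j < n \<and> h j = i. if j \<in> D then max 0 (c j - \<tau>) else u j)
      \<le> max 0 (assigned_load c h n i - \<tau>)" for i
  proof (cases "\<exists>j<n. h j = i")
    case False
    then have none: "{j. j < n \<and> h j = i} = {}" by blast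
    show ?thesis unfolding none by simp
  next
    case True
    define k where "k = (LEAST j. j < n \<and> h j = i)"
    have k: "k < n" "h k = i" using True LeastI_ex[of "\<lambda>j. j < n \<and> h j = i"] by (auto simp: k_def)
    have kle: "k \<le> j" if "j < n" "h j = i" for j
      unfolding k_def using that by (intro Least_le) auto
    define R where "R = {j. j < n \<and> h j = i} - {k}"
    have set: "{j. j < n \<and> h j = i} = insert k R" "k \<notin> R" "finite R"
      using k by (auto simp: R_def)
    have kD: "k \<in> D" using k kle by (auto simp: D_def) (meson leD less_trans)
    have RD: "j \<notin> D" if "j \<in> R" for j
      using that k kle[of j] by (auto simp: R_def D_def intro!: exI[of _ k])
    have lhs: "(\<Sum>j | j < n \<and> h j = i. if j \<in> D then max 0 (c j - \<tau>) else u j)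
        = max 0 (c k - \<tau>) + sum u R"
      using set kD RD by simp
    have rhs: "assigned_load c h n i = c k + sum c R"
      using set by (simp add: assigned_load_def)
    have uc: "u j \<le> c j" if "j \<in> R" for j
      using that pos[of j] \<tau> by (auto simp: u_def R_def)
    show ?thesis
    proof (cases "\<exists>r\<in>R. c r > \<tau> / 2")
      case False
      then have "sum u R = 0" by (intro sum.neutral) (auto simp: u_def)
      moreover have "0 \<le> sum c R" using pos by (intro sum_nonneg) (auto simp: R_def less_imp_le)
      ultimately show ?thesis unfolding lhs rhs by auto
    next
      case True
      then obtain r where r: "r \<in> R" "c r > \<tau> / 2" by blast
      have "c r \<le> c k" using r kle by (intro anti) (auto simp: R_def)
      \<comment> \<open>Job \<open>r\<close> alone saves \<open>\<tau> / 2\<close> in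
        \<open>sum u R\<close>. The first job \<open>k\<close> is at least as long as
        \<open>r\<close>, hence above \<open>\<tau> / 2\<close>, so
        \<open>max 0 (c k - \<tau>)\<close> is at most \<open>c k - \<tau> / 2\<close>; the two
        halves make up \<open>\<tau>\<close>.\<close>
      have "sum u (R - {r}) \<le> sum c (R - {r})" by (intro sum_mono uc) auto
      then have "sum u R + \<tau> / 2 \<le> sum c R"
        using r set(3) by (simp add: sum.remove[of R r] u_def)
      then show ?thesis unfolding lhs rhs using \<open>c r \<le> c k\<close> r \<tau> by auto
    qed
  qed
  have "(\<Sum>j<n. if j < m then max 0 (c j - \<tau>) else max 0 (c j - \<tau> / 2))
      = (\<Sum>j<n. u j - (if j < m then g j else 0))"
    by (intro sum.cong) (auto simp: u_def g_def)
  also have "\<dots> = sum u {..<n} - (\<Sum>j | j < n \<and> j < m. g j)"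
    by (simp add: sum_subtractf sum.If_cases lessThan_def Int_def conj_commute)
  also have "\<dots> \<le> sum u {..<n} - sum g D" using gD by simp
  also have "\<dots> = (\<Sum>j<n. u j - (if j \<in> D then g j else 0))"
  proof -
    have "{..<n} \<inter> D = D" by (auto simp: D_def)
    then show ?thesis by (simp add: sum_subtractf sum.If_cases)
  qed
  also have "\<dots> = (\<Sum>j<n. if j \<in> D then max 0 (c j - \<tau>) else u j)"
    by (intro sum.cong) (auto simp: g_def)
  also have "\<dots> = (\<Sum>i<m. \<Sum>j | j < n \<and> h j = i. if j \<in> D then max 0 (c j - \<tau>) else u j)"
    using sum.group[of "{..<n}" "{..<m}" h "\<lambda>j. if j \<in> D then max 0 (c j - \<tau>) else u j"] h
    by (auto simp: image_subset_iff)
  also have "\<dots> \<le> (\<Sum>i<m. max 0 (assigned_load c h n i - \<tau>))"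
    by (intro sum_mono machine)
  finally show ?thesis .
qed

section \<open>Structure of LPT assignments\<close>

text \<open>\<open>least\<close> is the greedy rule with arbitrary tie-breaking; combined with the
  order \<open>anti\<close> it gives LPT.\<close>

locale lpt =
  fixes m n :: nat and c :: "nat \<Rightarrow> real" and f :: "nat \<Rightarrow> nat"
  assumes pos: "\<And>j. j < n \<Longrightarrow> 0 < c j"
    and anti: "\<And>j k. j \<le> k \<Longrightarrow> k < n \<Longrightarrow> c k \<le> c j"
    and range: "\<And>j. j < n \<Longrightarrow> f j < m"
    and least: "\<And>j i. j < n \<Longrightarrow> i < m \<Longrightarrow> assigned_load c f j (f j) \<le> assigned_load c f j i"
begin

abbreviation L :: "nat \<Rightarrow> real" where
  "L \<equiv> assigned_load c f n"

lemma load_mono: "j \<le> n \<Longrightarrow> assigned_load c f j i \<le> L i"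
  unfolding assigned_load_def by (intro sum_mono2) (auto simp: pos less_imp_le)

lemma L_nonneg: "0 \<le> L i"
  unfolding assigned_load_def by (intro sum_nonneg) (auto simp: pos less_imp_le)

lemma load_ge: "j \<le> n \<Longrightarrow> k < j \<Longrightarrow> f k = i \<Longrightarrow> c k \<le> assigned_load c f j i"
  using assigned_load_ge[of j c "{k}" f i] pos by (force simp: less_imp_le)

lemma last_job:
  obtains "L i = 0" | q where "q < n" "f q = i" "L i = assigned_load c f q i + c q"
proof (cases "\<exists>j<n. f j = i")
  case False
  then have "L i = 0" by (intro assigned_load_eq_0) auto
  then show ?thesis using that(1) by blast
next
  case True
  define J where "J = {j. j < n \<and> f j = i}"
  define q where "q = Max J"
  have J: "finite J" "J \<noteq> {}" using True by (auto simp: J_def)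
  have q: "q \<in> J" unfolding q_def using J by (rule Max_in)
  have qmax: "j \<le> q" if "j \<in> J" for j unfolding q_def using J(1) that by (rule Max_ge)
  have "J - {q} = {j. j < q \<and> f j = i}"
    using q qmax by (fastforce simp: J_def)
  then have "L i = assigned_load c f q i + c q"
    using sum.remove[OF J(1) q, of c] by (simp add: assigned_load_def J_def)
  then show ?thesis using q that(2) by (auto simp: J_def)
qed

lemma empty_machine:
  assumes "j < m"
  obtains i where "i < m" "assigned_load c f j i = 0"
proof -
  have "\<not> {..<m} \<subseteq> f ` {..<j}"
  proof
    assume "{..<m} \<subseteq> f ` {..<j}"
    then have "card {..<m} \<le> card {..<j}" by (rule surj_card_le[rotated]) simp
    then show False using assms by simp
  qed
  then obtain i where "i < m" "i \<notin> f ` {..<j}" by auto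
  then show ?thesis using that by (metis assigned_load_eq_0 imageI lessThan_iff)
qed

text \<open>Fewer than \<open>m\<close> earlier jobs leave some machine empty, so the greedy rule
  picks an empty one.\<close>

lemma load_before_initial:
  assumes "j < n" "j < m"
  shows "assigned_load c f j (f j) = 0"
proof -
  obtain i where "i < m" "assigned_load c f j i = 0" using assms empty_machine by blast
  then have "assigned_load c f j (f j) \<le> 0" using least[OF assms(1)] by metis
  moreover have "0 \<le> assigned_load c f j (f j)"
    unfolding assigned_load_def using assms by (intro sum_nonneg) (auto simp: pos less_imp_le)
  ultimately show ?thesis by simp
qed

lemma initial_distinct:
  assumes "k < j" "j < n" "j < m"
  shows "f k \<noteq> f j"
proof
  assume "f k = f j"
  then have "c k \<le> assigned_load c f j (f j)" using assms by (intro load_ge) auto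
  then show False using load_before_initial[OF assms(2,3)] pos[of k] assms by simp
qed

section \<open>The factor 3/2 for any number of machines\<close>

lemma three_halves:
  assumes h: "\<And>j. j < n \<Longrightarrow> h j < m" and \<tau>: "0 \<le> \<tau>"
  shows "(\<Sum>i<m. max 0 (L i - 3 / 2 * \<tau>)) \<le> 3 / 2 * (\<Sum>i<m. max 0 (assigned_load c h n i - \<tau>))"
    (is "?lhs \<le> 3 / 2 * ?rhs")
proof (cases "\<forall>i<m. \<tau> \<le> L i")
  case True
  \<comment> \<open>Without truncation the excess is linear in the loads, and the total load is the
    same for \<open>f\<close> and \<open>h\<close>.\<close>
  have "?lhs \<le> (\<Sum>i<m. 3 / 2 * (L i - \<tau>))"
    using True \<tau> by (intro sum_mono) (auto simp: max_def algebra_simps)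
  also have "\<dots> = 3 / 2 * (\<Sum>i<m. L i - \<tau>)"
    by (rule sum_distrib_left[symmetric])
  also have "\<dots> = 3 / 2 * (\<Sum>i<m. assigned_load c h n i - \<tau>)"
    using sum_assigned_load[of n f m c] sum_assigned_load[of n h m c] range h
    by (simp add: sum_subtractf)
  also have "\<dots> \<le> 3 / 2 * ?rhs"
    by (intro mult_left_mono sum_mono) auto
  finally show ?thesis .
next
  case False
  then obtain i' where i': "i' < m" "L i' < \<tau>" by auto
  define w where "w = (\<lambda>j. if j < m then max 0 (c j - \<tau>) else max 0 (c j - \<tau> / 2))"
  have w0: "0 \<le> w j" for j by (auto simp: w_def)
  have "max 0 (L i - 3 / 2 * \<tau>) \<le> (\<Sum>j | j < n \<and> f j = i. w j)" for i
  proof (cases rule: last_job[of i])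
    case 1
    then show ?thesis using \<tau> w0 by (simp add: sum_nonneg)
  next
    case (2 q)
    \<comment> \<open>When \<open>q\<close> was placed, its machine was no fuller than
      \<open>i'\<close>, which stays below \<open>\<tau>\<close>. Hence
      \<open>L i - 3 / 2 * \<tau>\<close> is at most \<open>c q - \<tau> / 2\<close>; if
      \<open>q < m\<close>, then even \<open>L i = c q\<close>.\<close>
    have "assigned_load c f q i \<le> \<tau>"
      using least[of q i'] load_mono[of q i'] 2 i' by auto
    then have "max 0 (L i - 3 / 2 * \<tau>) \<le> w q"
      using load_before_initial[of q] 2 \<tau> by (auto simp: w_def)
    also have "w q \<le> (\<Sum>j | j < n \<and> f j = i. w j)"
      using 2 w0 by (intro member_le_sum) auto
    finally show ?thesis .
  qed
  then have "?lhs \<le> (\<Sum>i<m. \<Sum>j | j < n \<and> f j = i. w j)"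
    by (intro sum_mono)
  also have "\<dots> = (\<Sum>j<n. w j)"
    using sum_assigned_load[of n f m w] range by (simp add: assigned_load_def)
  also have "\<dots> \<le> ?rhs"
    unfolding w_def by (rule excess_lower_bound[OF pos anti h \<tau>])
  also have "\<dots> \<le> 3 / 2 * ?rhs"
    by (simp add: sum_nonneg)
  finally show ?thesis .
qed

section \<open>The factor 11/9 on three machines\<close>

text \<open>If the last job \<open>q\<close> of \<open>i\<close> meets a nonempty machine,
  greediness makes every machine nonempty at that stage. Each then holds a job at least as long as
  \<open>q\<close> and a load at least that of \<open>i\<close> before \<open>q\<close>.\<close>

lemma load_dichotomy:
  obtains "\<And>i'. i' < m \<Longrightarrow> L i \<le> 2 * L i'" | q where "q < n" "f q = i" "L i = c q"
proof (cases rule: last_job[of i])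
  case 1
  then show ?thesis using that(1) L_nonneg by simp
next
  case (2 q)
  show ?thesis
  proof (cases "assigned_load c f q i = 0")
    case True
    then show ?thesis using 2 that(2) by auto
  next
    case False
    have "0 \<le> assigned_load c f q i"
      unfolding assigned_load_def using 2 by (intro sum_nonneg) (auto simp: pos less_imp_le)
    with False have pre: "0 < assigned_load c f q i" by simp
    have "L i \<le> 2 * L i'" if i': "i' < m" for i'
    proof -
      have le: "assigned_load c f q i \<le> assigned_load c f q i'" using least[of q i'] 2 i' by auto
      have "\<exists>k<q. f k = i'"
      proof (rule ccontr)
        assume "\<not> (\<exists>k<q. f k = i')"
        then have "assigned_load c f q i' = 0" by (intro assigned_load_eq_0) auto
        then show False using le pre by simp
      qed
      then obtain k where k: "k < q" "f k = i'" by blast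
      have "c q \<le> c k" using k 2 by (intro anti) auto
      also have "c k \<le> assigned_load c f q i'" using k 2 by (intro load_ge) auto
      finally show ?thesis using le 2 load_mono[of q i'] by auto
    qed
    then show ?thesis by (rule that(1))
  qed
qed

text \<open>Graham's LPT bound \<open>4/3 - 1/(3 * m)\<close> at \<open>m = 3\<close>. A
  counterexample forces the last job \<open>q\<close> of machine \<open>i\<close> to be so long that
  no machine under \<open>h\<close> takes three of the jobs up to \<open>q\<close>; this leaves
  finitely many values of \<open>q\<close>.\<close>

lemma three_machines_makespan:
  assumes m: "m = 3" and h: "\<And>j. j < n \<Longrightarrow> h j < 3"
  shows "\<exists>j<3. L i \<le> 11 / 9 * assigned_load c h n j"
proof (rule ccontr)
  let ?H = "assigned_load c h n"
  define T where "T = 9 / 11 * L i"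
  assume "\<not> ?thesis"
  then have H: "?H j < T" if "j < 3" for j
    using that by (auto simp: T_def not_le field_simps)
  have Hge: "sum c A \<le> ?H j" if "A \<subseteq> {k. k < n \<and> h k = j}" for A j
    using that by (intro assigned_load_ge) (auto simp: pos less_imp_le)
  have T0: "0 < T" using H[of 0] Hge[of "{}" 0] by simp
  then have TL: "T < L i" by (simp add: T_def)
  show False
  proof (cases rule: last_job[of i])
    case 1
    then show False using T0 by (simp add: T_def)
  next
    case (2 q)
    define pre where "pre = assigned_load c f q i"
    have pre: "pre \<le> assigned_load c f q i'" if "i' < 3" for i'
      using least[of q i'] 2 that m by (auto simp: pre_def)
    \<comment> \<open>The total is below \<open>3 * T\<close> but at least
      \<open>3 * pre + c q\<close>, where \<open>pre + c q = L i = 11 / 9 * T\<close>.\<close>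
    have big: "T < 3 * c q"
    proof -
      have "3 * pre \<le> (\<Sum>i'<3. assigned_load c f q i')"
        using sum_bounded_below[of "{..<3}" pre "assigned_load c f q"] pre by simp
      also have "\<dots> = (\<Sum>j<q. c j)"
        using range 2 m by (intro sum_assigned_load) auto
      finally have "3 * pre + c q \<le> (\<Sum>j<Suc q. c j)" by simp
      also have "\<dots> \<le> (\<Sum>j<n. c j)"
        using 2 by (intro sum_mono2) (auto simp: pos less_imp_le)
      also have "\<dots> = (\<Sum>j<3. ?H j)"
        using h by (intro sum_assigned_load[symmetric]) auto
      also have "\<dots> < 3 * T"
        using H[of 0] H[of 1] H[of 2] by (simp add: eval_nat_numeral)
      finally show ?thesis using 2 by (simp add: T_def pre_def)
    qed
    have at_most_two: "card A \<le> 2 * card B" if A: "A \<subseteq> {..q}" "h ` A \<subseteq> B" and B: "B \<subseteq> {..<3}" for A B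
    proof -
      have fin: "finite A" "finite B" using A B finite_subset by blast+
      have "card {k \<in> A. h k = j} \<le> 2" if "j \<in> B" for j
      proof (rule ccontr)
        assume "\<not> ?thesis"
        then have "3 * c q \<le> of_nat (card {k \<in> A. h k = j}) * c q"
          using pos[of q] 2 by (intro mult_right_mono) auto
        also have "\<dots> \<le> sum c {k \<in> A. h k = j}"
          using A 2 by (intro sum_bounded_below anti) auto
        also have "\<dots> \<le> ?H j" using A 2 by (intro Hge) auto
        finally show False using H[of j] B that big by auto
      qed
      then have "(\<Sum>j\<in>B. card {k \<in> A. h k = j}) \<le> 2 * card B"
        using sum_bounded_above[of B "\<lambda>j. card {k \<in> A. h k = j}" 2] by (simp add: mult.commute)
      then show ?thesis
        using sum.group[OF fin A(2), of "\<lambda>_. 1::nat"] by simp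
    qed
    \<comment> \<open>The cases below play this against \<open>alone\<close>: a job at least
      \<open>pre\<close> long cannot share its machine under \<open>h\<close> with a later job up to
      \<open>q\<close>.\<close>
    have pair: "c a < pre" if "a < b" "b \<le> q" "h a = h b" for a b
    proof -
      have "c a + c q \<le> c a + c b" using anti[of b q] that 2 by simp
      also have "\<dots> \<le> ?H (h a)" using Hge[of "{a, b}" "h a"] that 2 by auto
      finally show ?thesis using H[of "h a"] h[of a] TL 2 that by (simp add: pre_def)
    qed
    have alone: "pre \<le> c a" if "a < q" "\<And>k. k < q \<Longrightarrow> k \<noteq> a \<Longrightarrow> f k \<noteq> f a" for a
    proof -
      have "{k. k < q \<and> f k = f a} = {a}" using that by auto
      then have "assigned_load c f q (f a) = c a" by (simp add: assigned_load_def)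
      then show ?thesis using pre[of "f a"] range[of a] that 2 m by simp
    qed
    have init: "f k \<noteq> f j" if "k < j" "j < 3" "j \<le> q" for k j
      using initial_distinct[of k j] that 2 m by simp
    have alone_initial: "pre \<le> c a"
      if a: "a < 3" "a < q" and later: "\<And>k. 3 \<le> k \<Longrightarrow> k < q \<Longrightarrow> f k \<noteq> f a" for a
    proof (rule alone[OF a(2)])
      fix k assume k: "k < q" "k \<noteq> a"
      consider "3 \<le> k" | "k < 3" "k < a" | "k < 3" "a < k" using k by linarith
      then show "f k \<noteq> f a"
        using later[of k] init[of k a] init[of a k] a k by cases auto
    qed
    have hq: "h k < 3" if "k \<le> q" for k using h[of k] that 2 by simp
    consider "q < 3" | "q = 3" | "q = 4" | "q = 5" | "6 \<le> q" by linarith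
    then show False
    proof cases
      case 1
      then have "pre = 0" using load_before_initial[of q] 2 m by (simp add: pre_def)
      then have "L i \<le> ?H (h q)" using Hge[of "{q}" "h q"] 2 by (simp add: pre_def)
      then show False using H[of "h q"] h[of q] TL 2 by simp
    next
      case 2
      have "pre \<le> c 2" using \<open>q = 3\<close> by (intro alone_initial) auto
      have "\<exists>a b. a < b \<and> b \<le> q \<and> h a = h b"
      proof (rule ccontr)
        assume "\<not> ?thesis"
        then have "inj_on h {..q}" by (auto simp: inj_on_def) (metis linorder_neqE_nat)
        moreover have "h ` {..q} \<subseteq> {..<3}" using hq by auto
        ultimately have "card {..q} \<le> card {..<3::nat}" by (intro card_inj_on_le) auto
        then show False using \<open>q = 3\<close> by simp
      qed
      then obtain a b where "a < b" "b \<le> q" "c a < pre" using pair by blast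
      then show False using anti[of a 2] \<open>pre \<le> c 2\<close> \<open>q = 3\<close> \<open>q < n\<close> by simp
    next
      case 3
      \<comment> \<open>Job 3 misses the machine of job 1 or that of job 2. Then jobs 0 and 1 each
        stand apart under \<open>h\<close>, and jobs 2, 3, 4 crowd onto one machine.\<close>
      have "pre \<le> c 1"
      proof (cases "f 3 = f 1")
        case True
        then have "f 3 \<noteq> f 2" using init[of 1 2] \<open>q = 4\<close> by simp
        then have "f k \<noteq> f 2" if "3 \<le> k" "k < q" for k
          using that \<open>q = 4\<close> by (cases "k = 3") auto
        then have "pre \<le> c 2" using \<open>q = 4\<close> by (intro alone_initial) auto
        then show ?thesis using anti[of 1 2] \<open>q = 4\<close> \<open>q < n\<close> by simp
      next
        case False
        then have "f k \<noteq> f 1" if "3 \<le> k" "k < q" for k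
          using that \<open>q = 4\<close> by (cases "k = 3") auto
        then show ?thesis using \<open>q = 4\<close> by (intro alone_initial) auto
      qed
      then have np: "h a \<noteq> h b" if "a \<le> 1" "a < b" "b \<le> 4" for a b
        using pair[of a b] anti[of a 1] that \<open>q = 4\<close> \<open>q < n\<close> by auto
      have "h ` {2..4} \<subseteq> {..<3} - {h 0, h 1}"
      proof (rule image_subsetI)
        fix k :: nat assume "k \<in> {2..4}"
        then show "h k \<in> {..<3} - {h 0, h 1}"
          using np[of 0 k] np[of 1 k] hq[of k] \<open>q = 4\<close> by simp
      qed
      then have "card {2..4::nat} \<le> 2 * card ({..<3} - {h 0, h 1})"
        using \<open>q = 4\<close> by (intro at_most_two) auto
      also have "card ({..<3} - {h 0, h 1}) = 1"
        using np[of 0 1] hq \<open>q = 4\<close> by (subst card_Diff_subset) auto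
      finally show False by simp
    next
      case 4
      \<comment> \<open>Jobs 3 and 4 cannot reach all three initial machines. Hence job 0 stands
        apart under \<open>h\<close>, and five jobs remain for two machines.\<close>
      obtain a where a: "a < 3" "f 3 \<noteq> f a" "f 4 \<noteq> f a"
      proof (rule ccontr)
        assume "\<not> thesis"
        then have "f 3 = f a \<or> f 4 = f a" if "a < 3" for a
          using that \<open>\<And>a. a < 3 \<Longrightarrow> f 3 \<noteq> f a \<Longrightarrow> f 4 \<noteq> f a \<Longrightarrow> thesis\<close> by blast
        from this[of 0] this[of 1] this[of 2] show False
          using init[of 0 1] init[of 0 2] init[of 1 2] \<open>q = 5\<close> by auto
      qed
      have "f k \<noteq> f a" if "3 \<le> k" "k < q" for k
      proof -
        have "k = 3 \<or> k = 4" using that \<open>q = 5\<close> by linarith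
        then show ?thesis using a by auto
      qed
      then have "pre \<le> c a" using a \<open>q = 5\<close> by (intro alone_initial) auto
      then have "pre \<le> c 0" using anti[of 0 a] a \<open>q = 5\<close> \<open>q < n\<close> by simp
      then have np: "h 0 \<noteq> h b" if "0 < b" "b \<le> 5" for b
        using pair[of 0 b] that \<open>q = 5\<close> by auto
      have "h ` {1..5} \<subseteq> {..<3} - {h 0}"
      proof (rule image_subsetI)
        fix k :: nat assume "k \<in> {1..5}"
        then show "h k \<in> {..<3} - {h 0}"
          using np[of k] hq[of k] \<open>q = 5\<close> by simp
      qed
      then have "card {1..5::nat} \<le> 2 * card ({..<3} - {h 0})"
        using \<open>q = 5\<close> by (intro at_most_two) auto
      also have "card ({..<3} - {h 0}) = 2"
        using hq \<open>q = 5\<close> by (subst card_Diff_subset) auto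
      finally show False by simp
    next
      case 5
      have "card {..q} \<le> 2 * card {..<3::nat}"
        using hq by (intro at_most_two) auto
      then show False using 5 by simp
    qed
  qed
qed

text \<open>For \<open>i\<close> the least loaded machine, the left side is the sum of the two
  largest loads. Failure for every \<open>j\<close> puts each load under \<open>h\<close> above
  \<open>(2 * P + 9 * L i) / 11\<close>, which \<open>load_dichotomy\<close> for the other two
  machines excludes.\<close>

lemma three_machines_two_largest:
  assumes m: "m = 3" and h: "\<And>j. j < n \<Longrightarrow> h j < 3" and i: "i < 3"
  shows "\<exists>j<3. (\<Sum>k<n. c k) - L i \<le> 11 / 9 * ((\<Sum>k<n. c k) - assigned_load c h n j)"
proof (rule ccontr)
  let ?H = "assigned_load c h n"
  define P where "P = (\<Sum>k<n. c k)"
  assume "\<not> ?thesis"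
  then have H: "2 * P + 9 * L i < 11 * ?H j" if "j < 3" for j
    using that by (auto simp: P_def not_le field_simps)
  have sum3: "(\<Sum>i<3. g i) = g 0 + g 1 + g 2" for g :: "nat \<Rightarrow> real"
    by (simp add: eval_nat_numeral)
  have HP: "?H 0 + ?H 1 + ?H 2 = P"
    using sum_assigned_load[of n h 3 c] h by (simp add: P_def sum3)
  obtain i1 i2 where i12: "i1 < 3" "i2 < 3" "i1 \<noteq> i2" "i1 \<noteq> i" "i2 \<noteq> i"
  proof -
    have "i = 0 \<or> i = 1 \<or> i = 2" using i by linarith
    then show ?thesis using that[of 1 2] that[of 0 2] that[of 0 1] by auto
  qed
  have LP: "L i + L i1 + L i2 = P"
  proof -
    have "{..<3} = {i, i1, i2}"
      using i i12 by (intro card_subset_eq[symmetric]) auto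
    then show ?thesis
      using sum_assigned_load[of n f 3 c] range m i12 by (simp add: P_def)
  qed
  have nonneg: "0 \<le> L k" for k by (rule L_nonneg)
  have PL: "27 * L i < 5 * P" using H[of 0] H[of 1] H[of 2] HP by simp
  have one_single: False
    if q: "q < n" "x = c q" and xy: "x + y + L i = P" "y \<le> 2 * L i" for q x y
  proof -
    have "x \<le> ?H (h q)"
      using assigned_load_ge[of n c "{q}" h "h q"] q by (auto simp: pos less_imp_le)
    moreover have "h q = 0 \<or> h q = 1 \<or> h q = 2" using h[OF q(1)] by linarith
    ultimately have "11 * x + 2 * (2 * P + 9 * L i) < 11 * P"
      using H[of 0] H[of 1] H[of 2] HP by auto
    then have "4 * x + 11 * L i < 7 * y" using xy by (simp add: algebra_simps)
    moreover have "22 * L i < 5 * x + 5 * y" using xy PL by (simp add: algebra_simps)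
    \<comment> \<open>With \<open>y \<le> 2 * L i\<close> the two inequalities give
      \<open>4 * x < 3 * L i\<close> and \<open>12 * L i < 5 * x\<close>.\<close>
    ultimately show False using xy(2) nonneg[of i] by linarith
  qed
  show False
  proof (cases rule: load_dichotomy[of i1])
    case 1
    show False
    proof (cases rule: load_dichotomy[of i2])
      case 1
      \<comment> \<open>Both bounds give \<open>P \<le> 5 * L i\<close>, against
        \<open>27 * L i < 5 * P\<close>.\<close>
      then show False using \<open>\<And>i'. i' < m \<Longrightarrow> L i1 \<le> 2 * L i'\<close>[of i] i m LP PL nonneg[of i] by force
    next
      case (2 q)
      then show False using one_single[of q "L i2" "L i1"] 1[of i] i m LP by simp
    qed
  next
    case (2 q1)
    show False
    proof (cases rule: load_dichotomy[of i2])
      case 1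
      then show False using one_single[of q1 "L i1" "L i2"] 2 i m LP by simp
    next
      case (2 q2)
      have q12: "q1 \<noteq> q2" using \<open>f q1 = i1\<close> \<open>f q2 = i2\<close> i12 by auto
      \<comment> \<open>A machine avoiding both single jobs has load at most
        \<open>P - L i1 - L i2 = L i\<close>, whereas \<open>H\<close> demands more than
        \<open>L i\<close>.\<close>
      obtain j where j: "j < 3" "j \<noteq> h q1" "j \<noteq> h q2"
        using that[of 0] that[of 1] that[of 2] by fastforce
      have "sum c (insert q1 (insert q2 {k. k < n \<and> h k = j})) \<le> P"
        unfolding P_def using \<open>q1 < n\<close> \<open>q2 < n\<close> by (intro sum_mono2) (auto simp: pos less_imp_le)
      then have "L i1 + L i2 + ?H j \<le> P"
        using j q12 \<open>L i1 = c q1\<close> \<open>L i2 = c q2\<close> by (simp add: assigned_load_def)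
      then show False using H[OF j(1)] LP nonneg[of i1] nonneg[of i2] by linarith
    qed
  qed
qed

lemma three_machines:
  assumes m: "m = 3" and h: "\<And>j. j < n \<Longrightarrow> h j < 3"
  shows "(\<Sum>i<3. max 0 (L i - t)) \<le> (\<Sum>i<3. max 0 (11 / 9 * assigned_load c h n i - t))"
proof -
  let ?H = "assigned_load c h n"
  define P where "P = (\<Sum>k<n. c k)"
  define M where "M = (\<lambda>i. max 0 (11 / 9 * ?H i - t))"
  define R where "R = (\<Sum>i<3. M i)"
  have sum3: "(\<Sum>i<3. g i) = g 0 + g 1 + g 2" for g :: "nat \<Rightarrow> real"
    by (simp add: eval_nat_numeral)
  have cases3: "j = 0 \<or> j = 1 \<or> j = 2" if "j < 3" for j :: nat using that by linarith
  have HP: "?H 0 + ?H 1 + ?H 2 = P"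
    using sum_assigned_load[of n h 3 c] h by (simp add: P_def sum3)
  have LP: "L 0 + L 1 + L 2 = P"
    using sum_assigned_load[of n f 3 c] range m by (simp add: P_def sum3)
  have P0: "0 \<le> P" unfolding P_def by (intro sum_nonneg) (auto simp: pos less_imp_le)
  have R: "R = M 0 + M 1 + M 2"
    by (simp add: R_def sum3)
  have M: "11 / 9 * ?H j - t \<le> M j" "0 \<le> M j" for j by (simp_all add: M_def)
  have R0: "0 \<le> R" using M(2) unfolding R by (simp add: add_nonneg_nonneg)
  have R1: "L i - t \<le> R" for i
  proof -
    obtain j where "j < 3" "L i \<le> 11 / 9 * ?H j" using three_machines_makespan[OF m, of h i] h by blast
    then show ?thesis using cases3[of j] M[of 0] M[of 1] M[of 2] unfolding R by auto
  qed
  have R2: "P - L i - 2 * t \<le> R" if i: "i < 3" for i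
  proof -
    obtain j where "j < 3" "P - L i \<le> 11 / 9 * (P - ?H j)"
      using three_machines_two_largest[OF m, of h i] h i unfolding P_def by blast
    moreover have "11 / 9 * (P - ?H j) \<le> R + 2 * t"
    proof -
      have "11 / 9 * (P - ?H 0) \<le> R + 2 * t" "11 / 9 * (P - ?H 1) \<le> R + 2 * t"
        "11 / 9 * (P - ?H 2) \<le> R + 2 * t"
        using HP M[of 0] M[of 1] M[of 2] unfolding R by argo+
      then show ?thesis using cases3[OF \<open>j < 3\<close>] by blast
    qed
    ultimately show ?thesis by linarith
  qed
  have R3: "P - 3 * t \<le> R" using HP P0 M[of 0] M[of 1] M[of 2] unfolding R by argo
  \<comment> \<open>The sum of positive parts is the largest sum of \<open>L i - t\<close> over a
    set of machines; \<open>R0\<close> to \<open>R3\<close> cover sets of size 0 to 3.\<close>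
  have "max 0 (L 0 - t) + max 0 (L 1 - t) + max 0 (L 2 - t) \<le> R"
    using R0 R1[of 0] R1[of 1] R1[of 2] R2[of 0] R2[of 1] R2[of 2] R3 LP
    by (simp add: max_def)
  then show ?thesis by (simp add: R_def M_def sum3)
qed

end

section \<open>From assignments to timed schedules\<close>

lemma assigned_load_permute:
  assumes "\<pi> permutes {..<n}"
  shows "assigned_load (\<lambda>j. c (\<pi> j)) (\<lambda>j. f (\<pi> j)) n i = assigned_load c f n i"
proof -
  have eq: "assigned_load c f n i = (\<Sum>j<n. if f j = i then c j else 0)" for c :: "nat \<Rightarrow> real" and f
    unfolding assigned_load_def by (simp add: sum.If_cases Int_def lessThan_def)
  show ?thesis
    unfolding eq using sum.permute[OF assms, of "\<lambda>j. if f j = i then c j else 0"]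
    by (simp add: comp_def)
qed

text \<open>Each machine runs its jobs without idle time in the index order of \<open>p\<close>, not
  in LPT order; the order within a machine does not affect its load.\<close>

definition compact_schedule :: "real list \<Rightarrow> (nat \<Rightarrow> nat) \<Rightarrow> schedule" where
  "compact_schedule p f = \<lparr>machine = f, start = \<lambda>j. assigned_load ((!) p) f j (f j)\<rparr>"

lemma compact_schedule_end_le:
  assumes "p \<in> instances" "j < k" "k \<le> length p" "f j = i"
  shows "assigned_load ((!) p) f j i + p ! j \<le> assigned_load ((!) p) f k i"
proof -
  have "assigned_load ((!) p) f j i + p ! j = assigned_load ((!) p) f (Suc j) i"
    using assms by (simp add: assigned_load_Suc)
  also have "\<dots> \<le> assigned_load ((!) p) f k i"
    unfolding assigned_load_def
    using assms by (intro sum_mono2) (auto simp: instances_def less_imp_le)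
  finally show ?thesis .
qed

lemma compact_schedule_feasible:
  assumes p: "p \<in> instances" and f: "\<And>j. j < length p \<Longrightarrow> f j < m"
  shows "compact_schedule p f \<in> feasible m p"
proof -
  have start: "0 \<le> assigned_load ((!) p) f j (f j)" if "j < length p" for j
    unfolding assigned_load_def using p that by (intro sum_nonneg) (auto simp: instances_def less_imp_le)
  have disj: "{assigned_load ((!) p) f j (f j) ..< assigned_load ((!) p) f j (f j) + p ! j} \<inter>
      {assigned_load ((!) p) f k (f k) ..< assigned_load ((!) p) f k (f k) + p ! k} = {}"
    if "j < length p" "k < length p" "j \<noteq> k" "f j = f k" for j k
    using compact_schedule_end_le[OF p, of j k f "f k"] compact_schedule_end_le[OF p, of k j f "f k"] that
    by (cases "j < k") auto
  show ?thesis
    using start disj f unfolding feasible_def compact_schedule_def by simp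
qed

lemma load_compact_schedule_le:
  assumes p: "p \<in> instances"
  shows "load p (compact_schedule p f) i \<le> assigned_load ((!) p) f (length p) i"
proof -
  have "0 \<le> assigned_load ((!) p) f (length p) i"
    unfolding assigned_load_def using p by (intro sum_nonneg) (auto simp: instances_def less_imp_le)
  then show ?thesis
    using compact_schedule_end_le[OF p, of _ "length p" f i]
    unfolding load_def compact_schedule_def by (subst Max_le_iff) auto
qed

text \<open>The jobs of a machine occupy disjoint intervals inside \<open>{0..load p T i}\<close>,
  so comparing Lebesgue measures bounds their total length.\<close>

lemma assigned_load_le_load:
  assumes p: "p \<in> instances" and T: "T \<in> feasible m p"
  shows "assigned_load ((!) p) (machine T) (length p) i \<le> load p T i"
proof -
  define J where "J = {j. j < length p \<and> machine T j = i}"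
  define I where "I = (\<lambda>j. {start T j ..< start T j + p ! j})"
  have finJ: "finite J" by (simp add: J_def)
  have ends: "start T j + p ! j \<le> load p T i" if "j \<in> J" for j
    unfolding load_def using that by (intro Max_ge) (auto simp: J_def)
  have load0: "0 \<le> load p T i"
    unfolding load_def by (intro Max_ge) auto
  have disj: "disjoint_family_on I J"
    using T by (auto simp: disjoint_family_on_def I_def J_def feasible_def)
  have sub: "(\<Union>j\<in>J. I j) \<subseteq> {0..load p T i}"
  proof (rule UN_least)
    fix j assume "j \<in> J"
    then have "0 \<le> start T j" using T by (auto simp: J_def feasible_def)
    then show "I j \<subseteq> {0..load p T i}" using ends[OF \<open>j \<in> J\<close>] by (auto simp: I_def)
  qed
  have "assigned_load ((!) p) (machine T) (length p) i = (\<Sum>j\<in>J. measure lborel (I j))"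
    unfolding assigned_load_def J_def[symmetric]
    using p by (intro sum.cong) (auto simp: I_def J_def instances_def less_imp_le)
  also have "\<dots> = measure lborel (\<Union>j\<in>J. I j)"
    using p by (intro measure_finite_Union[symmetric] finJ disj)
      (auto simp: I_def J_def instances_def less_imp_le)
  also have "\<dots> \<le> measure lborel {0..load p T i}"
    using finJ by (intro measure_mono_fmeasurable sub) (auto simp: I_def fmeasurable_def emeasure_lborel_Icc_eq)
  also have "\<dots> = load p T i" using load0 by simp
  finally show ?thesis .
qed

text \<open>Relabelling the jobs in sorted order reduces the ratio to an inequality between LPT
  loads and those of an arbitrary assignment. A single LPT schedule serves against all
  \<open>T\<close>.\<close>

lemma s_opt_leI:
  fixes \<alpha> :: real
  assumes p: "p \<in> instances" and m: "0 < m" and \<alpha>: "0 \<le> \<alpha>"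
    and lpt: "\<And>c f h t. lpt m (length p) c f \<Longrightarrow> (\<And>j. j < length p \<Longrightarrow> h j < m) \<Longrightarrow> 0 \<le> t \<Longrightarrow>
      (\<Sum>i<m. max 0 (assigned_load c f (length p) i - t))
        \<le> (\<Sum>i<m. max 0 (\<alpha> * assigned_load c h (length p) i - t))"
  shows "s_opt m p \<le> ereal \<alpha>"
proof -
  define n where "n = length p"
  have "mset (sort_desc p) = mset p" by (simp add: sort_desc_def)
  then obtain \<pi> where \<pi>: "\<pi> permutes {..<n}" and perm: "permute_list \<pi> p = sort_desc p"
    unfolding n_def by (rule mset_eq_permutation)
  define c where "c = (\<lambda>j. p ! \<pi> j)"
  have \<pi>n: "\<pi> j < n" if "j < n" for j using permutes_in_image[OF \<pi>, of j] that by simp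
  have c_sorted: "c j = sort_desc p ! j" if "j < n" for j
    using \<pi> that unfolding c_def perm[symmetric] n_def by (simp add: permute_list_nth)
  obtain f where f: "\<forall>j<n. f j < m"
      "\<forall>j<n. \<forall>i<m. assigned_load c f j (f j) \<le> assigned_load c f j i"
    using ex_list_schedule[OF m] by blast
  have lptf: "lpt m n c f"
  proof
    show "0 < c j" if "j < n" for j using p \<pi>n[OF that] by (simp add: c_def instances_def n_def)
    show "c k \<le> c j" if "j \<le> k" "k < n" for j k
      using that c_sorted[of j] c_sorted[of k]
      by (auto simp: sort_desc_def rev_nth n_def intro!: sorted_nth_mono)
  qed (use f in auto)
  \<comment> \<open>The LPT assignment \<open>f\<close> of sorted positions, carried back to the
    original job labels.\<close>
  define a where "a = (\<lambda>x. f (inv \<pi> x))"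
  have a\<pi>: "(\<lambda>j. a (\<pi> j)) = f" using permutes_inverses(2)[OF \<pi>] by (simp add: a_def)
  have inv_lt: "inv \<pi> x < n" if "x < n" for x
    using permutes_in_image[OF permutes_inv[OF \<pi>], of x] that by simp
  define S where "S = compact_schedule p a"
  have S: "S \<in> feasible m p"
    unfolding S_def using p f inv_lt by (intro compact_schedule_feasible) (auto simp: a_def n_def)
  have LS: "load p S i \<le> assigned_load c f n i" for i
    using load_compact_schedule_le[OF p, of a i] assigned_load_permute[OF \<pi>, of "(!) p" a i]
    unfolding S_def a\<pi> c_def n_def by simp
  have "load_vector m p S \<preceq>\<^sub>s map ((*) \<alpha>) (load_vector m p T)" if T: "T \<in> feasible m p" for T
  proof (rule weakly_submajorizedI)
    have load0: "0 \<le> load p T i" for i unfolding load_def by (intro Max_ge) auto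
    show "length (load_vector m p S) = length (map ((*) \<alpha>) (load_vector m p T))"
      by (simp add: load_vector_def)
    show "0 \<le> y" if "y \<in> set (map ((*) \<alpha>) (load_vector m p T))" for y
      using that \<alpha> load0 by (auto simp: load_vector_def)
    fix t :: real assume t: "0 \<le> t"
    define h where "h = (\<lambda>j. machine T (\<pi> j))"
    have h: "h j < m" if "j < n" for j
      using T \<pi>n[OF that] by (simp add: h_def feasible_def n_def)
    have HT: "assigned_load c h n i \<le> load p T i" for i
      using assigned_load_le_load[OF p T, of i] assigned_load_permute[OF \<pi>, of "(!) p" "machine T" i]
      unfolding h_def c_def n_def by simp
    have "(\<Sum>i<m. max 0 (load p S i - t)) \<le> (\<Sum>i<m. max 0 (assigned_load c f n i - t))"
      using LS by (intro sum_mono max.mono) (auto simp: diff_right_mono)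
    also have "\<dots> \<le> (\<Sum>i<m. max 0 (\<alpha> * assigned_load c h n i - t))"
      using lpt[of c f h t] lptf h t unfolding n_def by blast
    also have "\<dots> \<le> (\<Sum>i<m. max 0 (\<alpha> * load p T i - t))"
      using HT \<alpha> by (intro sum_mono max.mono diff_right_mono mult_left_mono) auto
    finally show "(\<Sum>x\<leftarrow>load_vector m p S. max 0 (x - t))
        \<le> (\<Sum>y\<leftarrow>map ((*) \<alpha>) (load_vector m p T). max 0 (y - t))"
      by (simp add: load_vector_def comp_def interv_sum_list_conv_sum_set_nat atLeast0LessThan)
  qed
  then have "s_ratio m p S \<le> ereal \<alpha>"
    unfolding s_ratio_def by (intro Inf_lower) blast
  then show ?thesis
    unfolding s_opt_def using S by (rule INF_lower2[rotated])
qed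

theorem theorem2:
  shows "(\<forall>m::nat. m \<ge> 4 \<longrightarrow> WAR_NP m \<le> ereal (3 / 2)) \<and> WAR_NP 3 \<le> ereal (sqrt 5 - 1)"
proof (intro conjI allI impI)
  fix m :: nat assume m: "4 \<le> m"
  show "WAR_NP m \<le> ereal (3 / 2)"
    unfolding WAR_NP_def
  proof (intro SUP_least s_opt_leI)
    fix p c f h and t :: real
    assume lpt: "lpt m (length p) c f" and h: "\<And>j. j < length p \<Longrightarrow> h j < m" and t: "0 \<le> t"
    \<comment> \<open>Pulling out the factor turns the threshold \<open>t\<close> into
      \<open>\<tau> = 2 / 3 * t\<close>.\<close>
    have scale: "max 0 (3 / 2 * x - t) = 3 / 2 * max 0 (x - 2 / 3 * t)" for x :: real
      by (auto simp: max_def)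
    show "(\<Sum>i<m. max 0 (assigned_load c f (length p) i - t))
        \<le> (\<Sum>i<m. max 0 (3 / 2 * assigned_load c h (length p) i - t))"
      unfolding scale sum_distrib_left[symmetric]
      using lpt.three_halves[OF lpt, of h "2 / 3 * t"] h t by simp
  qed (use m in auto)
next
  have "WAR_NP 3 \<le> ereal (11 / 9)"
    unfolding WAR_NP_def
    by (intro SUP_least s_opt_leI lpt.three_machines) auto
  \<comment> \<open>Equivalent to \<open>(20 / 9)^2 = 400 / 81 \<le> 5\<close>.\<close>
  also have "11 / 9 \<le> sqrt 5 - 1"
    using real_le_rsqrt[of "20 / 9" 5] by (simp add: power2_eq_square)
  finally show "WAR_NP 3 \<le> ereal (sqrt 5 - 1)" by simp
qed

end
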